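(* Let $n$ be a positive integer and let $\alpha_k\in\mathbb{Z}$ for $1\le k\le n$ be such that $\sum_{k=1}^{n}\alpha_k$ is odd. Let $G:\mathbb{R}_-\to\mathbb{R}_-$ be given, let $\psi(x)=-x$, $H(x):=\psi^{-1}(G(\psi(x)))$ for $x\in\mathbb{R}_+$, let $\mathcal{X}\subseteq\mathcal{C}_b(\mathbb{R}_-)$ and $\mathcal{Y}:=\{\psi^{-1}\circ g\circ\psi: g\in\mathcal{X}\}\subseteq\mathcal{C}_b(\mathbb{R}_+)$. Then a map $g$ is a solution (resp. the unique solution) in $\mathcal{X}$ of $$(g(x))^{\alpha_1}(g^{2}(x))^{\alpha_2}\cdots(g^{n}(x))^{\alpha_n}=G(x),\qquad x\in\mathbb{R}_-,$$ if and only if $h(x):=\psi^{-1}(g(\psi(x)))$ is a solution (resp. the unique solution) in $\mathcal{Y}$ of $$(h(x))^{\alpha_1}(h^{2}(x))^{\alpha_2}\cdots(h^{n}(x))^{\alpha_n}=H(x),\qquad x\in\mathbb{R}_+.$$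
   Context: $\mathbb{R}_+:=(0,+\infty)$, $\mathbb{R}_-:=(-\infty,0)$. $\mathcal{C}_b(\mathbb{R}_\pm)$ is the set of all bounded continuous self-maps of $\mathbb{R}_\pm$. For a self-map $g$, $g^k$ denotes the $k$-th iterate ($g^0=\mathrm{id}$, $g^{k+1}=g\circ g^k$), while $(g^k(x))^{\alpha_k}$ is the integer power of the number $g^k(x)$. *)

theory Defs
  imports "HOL-Analysis.Analysis" "HOL-Library.FuncSet"
begin

abbreviation Rpos :: "real set" where "Rpos \<equiv> {0<..}"

abbreviation Rneg :: "real set" where "Rneg \<equiv> {..<0}"

text \<open>
  A self-map of a set \<open>S\<close> of reals is an element of \<open>S \<rightarrow>\<^sub>E S\<close>. Being extensional, two self-maps
  are equal exactly when they agree on \<open>S\<close>, so uniqueness of solutions can be stated with plain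
  HOL equality.
\<close>

definition Cb :: "real set \<Rightarrow> (real \<Rightarrow> real) set" where
  "Cb S = {g \<in> S \<rightarrow>\<^sub>E S. continuous_on S g \<and> bounded (g ` S)}"

text \<open>
  For \<open>x \<in> S\<close> and a self-map \<open>g\<close> of \<open>S\<close>, all iterates of \<open>x\<close> stay in \<open>S\<close>, so \<open>g ^^ k\<close> is the
  iterate of the self-map even though it is formed on the whole type.
\<close>

definition solution_in ::
  "real set \<Rightarrow> nat \<Rightarrow> (nat \<Rightarrow> int) \<Rightarrow> (real \<Rightarrow> real) \<Rightarrow> (real \<Rightarrow> real) set \<Rightarrow> (real \<Rightarrow> real) \<Rightarrow> bool"
where
  "solution_in S n \<alpha> F \<F> g \<longleftrightarrow>
     g \<in> \<F> \<and> (\<forall>x\<in>S. (\<Prod>k=1..n. ((g ^^ k) x) powi (\<alpha> k)) = F x)"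

definition unique_solution_in ::
  "real set \<Rightarrow> nat \<Rightarrow> (nat \<Rightarrow> int) \<Rightarrow> (real \<Rightarrow> real) \<Rightarrow> (real \<Rightarrow> real) set \<Rightarrow> (real \<Rightarrow> real) \<Rightarrow> bool"
where
  "unique_solution_in S n \<alpha> F \<F> g \<longleftrightarrow>
     solution_in S n \<alpha> F \<F> g \<and> (\<forall>g'. solution_in S n \<alpha> F \<F> g' \<longrightarrow> g' = g)"

definition psi :: "real \<Rightarrow> real" where
  "psi x = - x"

text \<open>
  The map \<open>psi\<close> is regarded as a bijection from \<open>Rpos\<close> onto \<open>Rneg\<close>; accordingly its inverse is
  \<open>inv_into Rpos psi\<close>, which is meaningful on \<open>Rneg\<close> only.
\<close>

definition psi_conj :: "(real \<Rightarrow> real) \<Rightarrow> (real \<Rightarrow> real)" where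
  "psi_conj g = (\<lambda>x\<in>Rpos. inv_into Rpos psi (g (psi x)))"

lemma bij_betw_psi: "bij_betw psi Rpos Rneg"
  by (rule bij_betw_byWitness[where f' = uminus]) (auto simp: psi_def)

lemma inv_into_psi: "y \<in> Rneg \<Longrightarrow> inv_into Rpos psi y = - y"
  by (rule inv_into_f_eq) (auto simp: psi_def inj_on_def)

lemma psi_conj_apply: "g \<in> Rneg \<rightarrow> Rneg \<Longrightarrow> x \<in> Rpos \<Longrightarrow> psi_conj g x = - g (- x)"
  unfolding psi_conj_def by (simp add: inv_into_psi psi_def Pi_iff)

lemma psi_conj_in_PiE: "g \<in> Rneg \<rightarrow> Rneg \<Longrightarrow> psi_conj g \<in> Rpos \<rightarrow>\<^sub>E Rpos"
  by (rule PiE_I) (auto simp: psi_conj_apply Pi_iff, simp add: psi_conj_def)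

lemma psi_conj_in_Cb:
  assumes "g \<in> Cb Rneg"
  shows "psi_conj g \<in> Cb Rpos"
proof -
  have g: "g \<in> Rneg \<rightarrow> Rneg" and cont: "continuous_on Rneg g" and bdd: "bounded (g ` Rneg)"
    using assms by (auto simp: Cb_def)
  have "continuous_on Rpos (\<lambda>x. - g (- x))"
    by (intro continuous_intros continuous_on_compose2[OF cont]) auto
  then have "continuous_on Rpos (psi_conj g)"
    by (subst continuous_on_cong[OF refl psi_conj_apply[OF g]]) auto
  moreover have "psi_conj g ` Rpos \<subseteq> uminus ` g ` Rneg"
    using g by (force simp: psi_conj_apply)
  then have "bounded (psi_conj g ` Rpos)"
    using bdd bounded_subset by (metis bounded_uminus)
  ultimately show ?thesis
    using psi_conj_in_PiE[OF g] by (simp add: Cb_def)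
qed

end

theory Submission imports Defs begin

text \<open>Conjugation by \<open>psi\<close> sends \<open>g\<close> to x \<mapsto> -g(-x), and it
  commutes with iteration (\<open>funpow_psi_conj\<close>): the k-th iterate becomes -g^k(-x).
  Pulling the signs out of the product leaves the factor (-1) to the sum of the exponents
  (\<open>prod_powi_uminus\<close>), which is -1 because the sum is odd. The right-hand side also
  becomes -G(-x), so the signs cancel and the equation for \<open>h\<close> at x is the equation for
  \<open>g\<close> at -x. Conjugation is injective on self-maps (\<open>inj_on_psi_conj\<close>),
  hence a bijection from \<open>X\<close> onto \<open>Y\<close> that matches the two solution sets;
  uniqueness transfers with them.\<close>

lemma prod_powi_uminus:
  fixes a :: "'i \<Rightarrow> real"
  assumes "finite I"
  shows "(\<Prod>i\<in>I. (- a i) powi \<alpha> i) =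
    (if even (\<Sum>i\<in>I. \<alpha> i) then \<Prod>i\<in>I. a i powi \<alpha> i else - (\<Prod>i\<in>I. a i powi \<alpha> i))"
  using assms by (induction I) (auto simp: power_int_minus_left)

lemma funpow_mem: "g \<in> S \<rightarrow> S \<Longrightarrow> x \<in> S \<Longrightarrow> (g ^^ k) x \<in> S"
  by (induction k) auto

lemma funpow_psi_conj:
  assumes "g \<in> Rneg \<rightarrow> Rneg" "x \<in> Rpos"
  shows "(psi_conj g ^^ k) x = - (g ^^ k) (- x)"
proof (induction k)
  case (Suc k)
  \<comment> \<open>\<open>psi_conj g\<close> equals the negated formula only at positive points, so
    the current iterate of \<open>g\<close> must be known to be negative.\<close>
  have "(g ^^ k) (- x) \<in> Rneg"
    using assms by (intro funpow_mem) auto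
  then show ?case
    using Suc psi_conj_apply[OF assms(1)] by simp
qed simp

text \<open>The values on \<open>Rneg\<close> are recovered by conjugating back; off
  \<open>Rneg\<close> extensionality fixes them.\<close>

lemma inj_on_psi_conj: "inj_on psi_conj (Rneg \<rightarrow>\<^sub>E Rneg)"
proof (rule inj_onI)
  fix f g
  assume f: "f \<in> Rneg \<rightarrow>\<^sub>E Rneg" and g: "g \<in> Rneg \<rightarrow>\<^sub>E Rneg" and eq: "psi_conj f = psi_conj g"
  from f g show "f = g"
  proof (rule PiE_ext)
    fix x :: real
    assume "x \<in> Rneg"
    then show "f x = g x"
      using psi_conj_apply[of f "- x"] psi_conj_apply[of g "- x"] f g eq by (auto simp: PiE_def)
  qed
qed

lemma equation_psi_conj_iff:
  assumes "odd (\<Sum>k=1..n. \<alpha> k)" "G \<in> Rneg \<rightarrow> Rneg" "g \<in> Rneg \<rightarrow> Rneg"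
  shows "(\<forall>x\<in>Rpos. (\<Prod>k=1..n. ((psi_conj g ^^ k) x) powi \<alpha> k) = psi_conj G x) \<longleftrightarrow>
    (\<forall>x\<in>Rneg. (\<Prod>k=1..n. ((g ^^ k) x) powi \<alpha> k) = G x)"
proof -
  have "(\<Prod>k=1..n. ((psi_conj g ^^ k) x) powi \<alpha> k) = psi_conj G x \<longleftrightarrow>
      (\<Prod>k=1..n. ((g ^^ k) (- x)) powi \<alpha> k) = G (- x)" if "x \<in> Rpos" for x
    using that assms by (simp add: funpow_psi_conj psi_conj_apply prod_powi_uminus)
  \<comment> \<open>Negation maps \<open>Rpos\<close> onto \<open>Rneg\<close>, so the pointwise
    equivalence at x and -x covers both half-lines.\<close>
  moreover have "(\<forall>x\<in>Rneg. P x) \<longleftrightarrow> (\<forall>x\<in>Rpos. P (- x))" for P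
    using ball_simps(9)[of uminus Rpos P] by simp
  ultimately show ?thesis
    by (simp only: cong: ball_cong)
qed

text \<open>Besides the equation, membership has to transfer: injectivity ensures that
  \<open>psi_conj g\<close> lies in the image of \<open>X\<close> only if \<open>g\<close> itself
  lies in \<open>X\<close>.\<close>

lemma solution_in_psi_conj_iff:
  assumes "odd (\<Sum>k=1..n. \<alpha> k)" "G \<in> Rneg \<rightarrow> Rneg"
    and "X \<subseteq> Rneg \<rightarrow>\<^sub>E Rneg" "g \<in> Rneg \<rightarrow>\<^sub>E Rneg"
  shows "solution_in Rpos n \<alpha> (psi_conj G) (psi_conj ` X) (psi_conj g) \<longleftrightarrow>
    solution_in Rneg n \<alpha> G X g"
  unfolding solution_in_def
  using inj_on_image_mem_iff[OF inj_on_psi_conj assms(4,3)] equation_psi_conj_iff[OF assms(1,2)] assms(4)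
  by (simp add: PiE_def)

theorem proposition2:
  fixes n :: nat and \<alpha> :: "nat \<Rightarrow> int"
    and G H g h :: "real \<Rightarrow> real" and X Y :: "(real \<Rightarrow> real) set"
  assumes "n > 0"
    and "odd (\<Sum>k=1..n. \<alpha> k)"
    and "G \<in> Rneg \<rightarrow>\<^sub>E Rneg"
    and "H = psi_conj G"
    and "X \<subseteq> Cb Rneg"
    and "Y = psi_conj ` X"
    and "g \<in> Rneg \<rightarrow>\<^sub>E Rneg"
    and "h = psi_conj g"
  shows "(solution_in Rneg n \<alpha> G X g \<longleftrightarrow> solution_in Rpos n \<alpha> H Y h) \<and>
         (unique_solution_in Rneg n \<alpha> G X g \<longleftrightarrow> unique_solution_in Rpos n \<alpha> H Y h)"
proof -
  have X: "X \<subseteq> Rneg \<rightarrow>\<^sub>E Rneg"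
    using assms(5) by (auto simp: Cb_def)
  have G: "G \<in> Rneg \<rightarrow> Rneg"
    using assms(3) by (simp add: PiE_def)
  have sol: "solution_in Rpos n \<alpha> H Y (psi_conj f) \<longleftrightarrow> solution_in Rneg n \<alpha> G X f"
    if "f \<in> Rneg \<rightarrow>\<^sub>E Rneg" for f
    using solution_in_psi_conj_iff[OF assms(2) G X that] assms(4,6) by simp
  \<comment> \<open>Any competing solution lies in \<open>Y\<close>, hence is the conjugate of some
    \<open>f\<close> in \<open>X\<close>.\<close>
  have "(\<forall>h'. solution_in Rpos n \<alpha> H Y h' \<longrightarrow> h' = h) \<longleftrightarrow>
      (\<forall>f\<in>X. solution_in Rpos n \<alpha> H Y (psi_conj f) \<longrightarrow> psi_conj f = h)"
    using assms(6) by (auto simp: solution_in_def)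
  also have "\<dots> \<longleftrightarrow> (\<forall>f\<in>X. solution_in Rneg n \<alpha> G X f \<longrightarrow> f = g)"
  proof (rule ball_cong[OF refl])
    fix f
    assume "f \<in> X"
    with X have f: "f \<in> Rneg \<rightarrow>\<^sub>E Rneg" ..
    show "(solution_in Rpos n \<alpha> H Y (psi_conj f) \<longrightarrow> psi_conj f = h) \<longleftrightarrow>
        (solution_in Rneg n \<alpha> G X f \<longrightarrow> f = g)"
      by (simp only: sol[OF f] assms(8) inj_on_eq_iff[OF inj_on_psi_conj f assms(7)])
  qed
  also have "\<dots> \<longleftrightarrow> (\<forall>f. solution_in Rneg n \<alpha> G X f \<longrightarrow> f = g)"
    by (auto simp: solution_in_def)
  finally show ?thesis
    using sol[OF assms(7)] assms(8) by (simp add: unique_solution_in_def)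
qed

end
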